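(* Let $\bar{\mathscr C}=(\overline{\mathrm{Spec}\,\mathbf Z})_{\mathbf F_{1^2}}$ be the global absolute curve, viewed as an object internal to the odd arithmetic topos $\widehat{\mathbf N^\times_{\mathrm{odd}}}$, with structure sheaf $\mathcal O_{\bar{\mathscr C}}$ on which $n\in\mathbf N^\times_{\mathrm{odd}}$ acts by $\mathrm{Fr}_n(s)=s^n$. Then the space of global sections, in the sense of morphisms from the terminal object of the topos (i.e. sections over the whole curve that are fixed by $\mathrm{Fr}_n$ for every odd $n$), is precisely the base: $$\Gamma(\bar{\mathscr C},\mathcal O_{\bar{\mathscr C}})=\mathbf F_{1^2}.$$
   Context: **Spherical algebras.** $\mathbf F_1[M]$ is the spherical algebra of a commutative pointed monoid $M$ (with absorbing $0$ and unit $1$); its elements are understood as the elements of the multiplicative pointed monoid $M$. $\mathbf F_{1^2}=\mathbf F_1[\{0,1,\epsilon:\epsilon^2=1\}]$, with underlying pointed monoid $\{0,1,\epsilon\}$. $\mathbf F_{1^2}[M]$ has underlying pointed monoid $\{0,1,\epsilon\}\wedge M$. Sheaves of such algebras may be treated as sheaves of commutative pointed monoids equipped with a structure map from $\{0,1,\epsilon\}$; restriction maps are maps of $\mathbf F_{1^2}$-algebras. **Odd arithmetic topos.** $\mathbf N^\times_{\mathrm{odd}}$ is the multiplicative monoid of odd positive integers; $\widehat{\mathbf N^\times_{\mathrm{odd}}}$ is the topos of sets with an action of this monoid. The terminal object $\mathbf 1$ is the one-point set, and $\Gamma(Y)=\mathrm{Hom}(\mathbf 1,Y)$ is the set of elements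 of $Y$ fixed by the action. The monoid acts trivially on the topological space $|\bar{\mathscr C}|$. **Finite component.** $\mathscr C_{\mathrm{fin}}=(\mathrm{Spec}\,\mathbf Z)_{\mathbf F_{1^2}}$ has as underlying space $\mathrm{Spec}\,\mathbf Z$ with the Zariski topology: closed points are the primes $p\in\mathcal P$, together with a generic point $\eta_{\mathrm{fin}}$. Its structure sheaf $\mathcal O_{\mathrm{fin}}$ is a sheaf of $\mathbf F_{1^2}$-algebras whose stalk at $\eta_{\mathrm{fin}}$ is $\mathbf F_{1^2}$ and whose stalk at $p$ is $\mathbf F_{1^2}[T^{H_{p,+}}]$, where $(H_p,H_{p,+})$ is the ordered rank-one torsion-free abelian group attached to $p$ (the monoid is $\{0\}\cup\{\epsilon^aT^h: a\in\{0,1\},\ h\in H_{p,+}\}$ with $T^hT^{h'}=T^{h+h'}$). **Archimedean component.** $\mathcal X$ has underlying space $\{+,-,\eta\}$ with nontrivial opens $\Omega_\pm=\{\pm,\eta\}$, $\Omega=\{\eta\}$, and structure sheaf $\mathcal O(\Omega_+)=\mathbf F_{1^2}[T^{\mathbf Z_{\ge0}},J_+]/(J_+^2=\epsilon)$, $\mathcal O(\Omega_-)=\mathbf F_{1^2}[T^{\mathbf Z_{\le0}},J_-]/(J_-^2=\epsilon)$, $\mathcal O(\Omega)=\mathbf F_{1^2}[T^{\mathbf Z},J]/(J^2=\epsilon)$, with restriction maps to $\Omega$ the inclusions on powers of $T$ together with $J_+\mapsto J$, $J_-\mapsto\epsilon J$. The involution $\alpha$ exchanges $+$ and $-$, fixes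 $\eta$, and acts by $\alpha^*(T)=\epsilon T^{-1}$, $\alpha^*(J)=\epsilon J$ on $\mathcal O(\Omega)$ and by $\alpha_+^*:\mathcal O(\Omega_-)\to\mathcal O(\Omega_+)$, $T^{-1}\mapsto\epsilon T$, $J_-\mapsto J_+$, and $\alpha_-^*:\mathcal O(\Omega_+)\to\mathcal O(\Omega_-)$, $T\mapsto\epsilon T^{-1}$, $J_+\mapsto J_-$. The equivariant quotient $\mathscr C_\infty=[\mathcal X/\langle\alpha\rangle]$ has underlying space $\{\infty,\eta_\infty\}$, with $\infty$ the closed point (image of $\pm$) and $\eta_\infty$ the generic point (image of $\eta$; it is open). Sections $\mathcal O_\infty(V)$ over an open $V$ of $\mathscr C_\infty$ are the $\alpha$-invariant sections of $\mathcal O$ on the preimage of $V$; in particular the $\alpha$-invariant stalk at $\eta_\infty$ is $\mathbf F_{1^2}$. **The global curve.** $|\bar{\mathscr C}|=|\mathscr C_{\mathrm{fin}}|\coprod_{\eta_{\mathrm{fin}}\sim\eta_\infty}|\mathscr C_\infty|$ (pushout of topological spaces), with closed points $\mathcal P\cup\{\infty\}$ and a single generic point. For each nonempty open $U$, $$\mathcal O_{\bar{\mathscr C}}(U)=\mathcal O_{\mathrm{fin}}(U\cap\mathscr C_{\mathrm{fin}})\times_{\mathbf F_{1^2}}\mathcal O_\infty(U\cap\mathscr C_\infty),$$ the fiber product over the common generic stalk $\mathbf F_{1^2}$. *)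

theory Defs
  imports "HOL-Algebra.IntRing" "HOL-Analysis.Abstract_Topology"
begin

section \<open>Algebras over the base\<close>

text \<open>The pointed monoid {0, 1, epsilon} with epsilon * epsilon = 1.\<close>

datatype f12 = F0 | F1 | Feps

fun f12_mult :: "f12 \<Rightarrow> f12 \<Rightarrow> f12" where
  "f12_mult F0 y = F0"
| "f12_mult F1 y = y"
| "f12_mult Feps F0 = F0"
| "f12_mult Feps F1 = Feps"
| "f12_mult Feps Feps = F1"

record 'a f12_alg = "'a monoid" +
  pt :: 'a
  str :: "f12 \<Rightarrow> 'a"

definition F12 :: "f12 f12_alg" where
  "F12 = \<lparr>carrier = UNIV, mult = f12_mult, one = F1, pt = F0, str = (\<lambda>c. c)\<rparr>"

text \<open>A spherical algebra over the base is treated as a commutative pointed monoid (with absorbing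
  element \<open>pt\<close>) under {0, 1, epsilon}. The one-element algebra, in which the absorbing element and the
  unit coincide, is allowed: it is the value of a sheaf on the empty set.\<close>

locale f12_algebra = comm_monoid A for A :: "('a, 'm) f12_alg_scheme" (structure) +
  assumes pt_closed: "pt A \<in> carrier A"
    and pt_absorb: "x \<in> carrier A \<Longrightarrow> pt A \<otimes> x = pt A"
    and str_hom: "str A \<in> hom F12 A"
    and str_F0: "str A F0 = pt A"
    and str_F1: "str A F1 = \<one>"

definition f12_hom ::
  "('a, 'm) f12_alg_scheme \<Rightarrow> ('b, 'n) f12_alg_scheme \<Rightarrow> ('a \<Rightarrow> 'b) set" where
  "f12_hom A B = {f \<in> hom A B. f \<one>\<^bsub>A\<^esub> = \<one>\<^bsub>B\<^esub> \<and> f (pt A) = pt B \<and> (\<forall>c. f (str A c) = str B c)}"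

definition f12_iso ::
  "('a, 'm) f12_alg_scheme \<Rightarrow> ('b, 'n) f12_alg_scheme \<Rightarrow> ('a \<Rightarrow> 'b) set" where
  "f12_iso A B = {f \<in> f12_hom A B. bij_betw f (carrier A) (carrier B)}"

text \<open>\<open>Mon a h\<close> stands for \<open>\<epsilon>\<^sup>a T\<^sup>h\<close>, with \<open>a\<close> read modulo 2, and \<open>Nul\<close> for the absorbing element. The algebra
  below is the one whose pointed monoid is the smash product of {0, 1, epsilon} with M, to which a
  zero is adjoined.\<close>

datatype 'h monomial = Nul | Mon bool 'h

fun monomial_mult :: "('h, 'm) monoid_scheme \<Rightarrow> 'h monomial \<Rightarrow> 'h monomial \<Rightarrow> 'h monomial" where
  "monomial_mult M (Mon a h) (Mon b k) = Mon (a \<noteq> b) (h \<otimes>\<^bsub>M\<^esub> k)"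
| "monomial_mult M Nul y = Nul"
| "monomial_mult M x Nul = Nul"

definition F12_monoid_algebra :: "('h, 'm) monoid_scheme \<Rightarrow> 'h monomial f12_alg" where
  "F12_monoid_algebra M =
     \<lparr>carrier = insert Nul {Mon a h | a h. h \<in> carrier M},
      mult = monomial_mult M,
      one = Mon False \<one>\<^bsub>M\<^esub>,
      pt = Nul,
      str = (\<lambda>c. case c of F0 \<Rightarrow> Nul | F1 \<Rightarrow> Mon False \<one>\<^bsub>M\<^esub> | Feps \<Rightarrow> Mon True \<one>\<^bsub>M\<^esub>)\<rparr>"

inductive_set f12_cong :: "('a, 'm) f12_alg_scheme \<Rightarrow> 'a rel \<Rightarrow> 'a rel"
  for A :: "('a, 'm) f12_alg_scheme" (structure) and R :: "'a rel" where
  cong_base: "(x, y) \<in> R \<Longrightarrow> x \<in> carrier A \<Longrightarrow> y \<in> carrier A \<Longrightarrow> (x, y) \<in> f12_cong A R"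
| cong_refl: "x \<in> carrier A \<Longrightarrow> (x, x) \<in> f12_cong A R"
| cong_sym: "(x, y) \<in> f12_cong A R \<Longrightarrow> (y, x) \<in> f12_cong A R"
| cong_trans: "(x, y) \<in> f12_cong A R \<Longrightarrow> (y, z) \<in> f12_cong A R \<Longrightarrow> (x, z) \<in> f12_cong A R"
| cong_mult: "(x, y) \<in> f12_cong A R \<Longrightarrow> z \<in> carrier A \<Longrightarrow> (z \<otimes> x, z \<otimes> y) \<in> f12_cong A R"

definition f12_quot :: "('a, 'm) f12_alg_scheme \<Rightarrow> 'a rel \<Rightarrow> 'a set f12_alg" where
  "f12_quot A R =
     \<lparr>carrier = carrier A // f12_cong A R,
      mult = (\<lambda>C D. f12_cong A R `` (C <#>\<^bsub>A\<^esub> D)),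
      one = f12_cong A R `` {\<one>\<^bsub>A\<^esub>},
      pt = f12_cong A R `` {pt A},
      str = (\<lambda>c. f12_cong A R `` {str A c})\<rparr>"

section \<open>Sheaves of algebras and their stalks\<close>

text \<open>\<open>rest F U V\<close> is the restriction map from U to V, used only for open V contained in U.\<close>

record ('p, 'a) presheaf =
  sect :: "'p set \<Rightarrow> 'a f12_alg"
  rest :: "'p set \<Rightarrow> 'p set \<Rightarrow> 'a \<Rightarrow> 'a"

locale f12_presheaf =
  fixes X :: "'p topology" and F :: "('p, 'a) presheaf"
  assumes sect_alg: "openin X U \<Longrightarrow> f12_algebra (sect F U)"
    and rest_hom: "openin X U \<Longrightarrow> openin X V \<Longrightarrow> V \<subseteq> U \<Longrightarrow> rest F U V \<in> f12_hom (sect F U) (sect F V)"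
    and rest_id: "openin X U \<Longrightarrow> s \<in> carrier (sect F U) \<Longrightarrow> rest F U U s = s"
    and rest_comp: "openin X U \<Longrightarrow> openin X V \<Longrightarrow> openin X W \<Longrightarrow> W \<subseteq> V \<Longrightarrow> V \<subseteq> U \<Longrightarrow>
      s \<in> carrier (sect F U) \<Longrightarrow> rest F V W (rest F U V s) = rest F U W s"

locale f12_sheaf = f12_presheaf +
  assumes separated: "(\<And>V. V \<in> \<U> \<Longrightarrow> openin X V) \<Longrightarrow>
      s \<in> carrier (sect F (\<Union>\<U>)) \<Longrightarrow> t \<in> carrier (sect F (\<Union>\<U>)) \<Longrightarrow>
      (\<And>V. V \<in> \<U> \<Longrightarrow> rest F (\<Union>\<U>) V s = rest F (\<Union>\<U>) V t) \<Longrightarrow> s = t"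
    and gluing: "(\<And>V. V \<in> \<U> \<Longrightarrow> openin X V) \<Longrightarrow>
      (\<And>V. V \<in> \<U> \<Longrightarrow> \<sigma> V \<in> carrier (sect F V)) \<Longrightarrow>
      (\<And>V W. V \<in> \<U> \<Longrightarrow> W \<in> \<U> \<Longrightarrow> rest F V (V \<inter> W) (\<sigma> V) = rest F W (V \<inter> W) (\<sigma> W)) \<Longrightarrow>
      \<exists>s \<in> carrier (sect F (\<Union>\<U>)). \<forall>V\<in>\<U>. rest F (\<Union>\<U>) V s = \<sigma> V"

definition local_sections :: "'p topology \<Rightarrow> ('p, 'a) presheaf \<Rightarrow> 'p \<Rightarrow> ('p set \<times> 'a) set" where
  "local_sections X F x = {(U, s). openin X U \<and> x \<in> U \<and> s \<in> carrier (sect F U)}"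

definition germ_rel :: "'p topology \<Rightarrow> ('p, 'a) presheaf \<Rightarrow> 'p \<Rightarrow> ('p set \<times> 'a) rel" where
  "germ_rel X F x = {((U, s), (V, t)).
     (U, s) \<in> local_sections X F x \<and> (V, t) \<in> local_sections X F x \<and>
     (\<exists>W. openin X W \<and> x \<in> W \<and> W \<subseteq> U \<inter> V \<and> rest F U W s = rest F V W t)}"

definition germ :: "'p topology \<Rightarrow> ('p, 'a) presheaf \<Rightarrow> 'p \<Rightarrow> 'p set \<Rightarrow> 'a \<Rightarrow> ('p set \<times> 'a) set" where
  "germ X F x U s = germ_rel X F x `` {(U, s)}"

definition stalk :: "'p topology \<Rightarrow> ('p, 'a) presheaf \<Rightarrow> 'p \<Rightarrow> ('p set \<times> 'a) set f12_alg" where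
  "stalk X F x =
     \<lparr>carrier = local_sections X F x // germ_rel X F x,
      mult = (\<lambda>C D. germ_rel X F x ``
        {(U \<inter> V, rest F U (U \<inter> V) s \<otimes>\<^bsub>sect F (U \<inter> V)\<^esub> rest F V (U \<inter> V) t) | U V s t.
           (U, s) \<in> C \<and> (V, t) \<in> D}),
      one = germ X F x (topspace X) \<one>\<^bsub>sect F (topspace X)\<^esub>,
      pt = germ X F x (topspace X) (pt (sect F (topspace X))),
      str = (\<lambda>c. germ X F x (topspace X) (str (sect F (topspace X)) c))\<rparr>"

section \<open>The odd arithmetic topos\<close>

text \<open>Objects are sets with an action of the multiplicative monoid of odd positive integers; the value
  of \<open>act\<close> at even arguments is irrelevant.\<close>

record 'a odd_set =
  points :: "'a set"
  act :: "nat \<Rightarrow> 'a \<Rightarrow> 'a"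

definition is_odd_set :: "'a odd_set \<Rightarrow> bool" where
  "is_odd_set Y \<longleftrightarrow>
     (\<forall>n x. odd n \<longrightarrow> x \<in> points Y \<longrightarrow> act Y n x \<in> points Y) \<and>
     (\<forall>x\<in>points Y. act Y 1 x = x) \<and>
     (\<forall>m n. odd m \<longrightarrow> odd n \<longrightarrow> (\<forall>x\<in>points Y. act Y (m * n) x = act Y m (act Y n x)))"

definition odd_hom :: "'a odd_set \<Rightarrow> 'b odd_set \<Rightarrow> ('a \<Rightarrow> 'b) set" where
  "odd_hom Y Z = {f \<in> points Y \<rightarrow>\<^sub>E points Z. \<forall>n x. odd n \<longrightarrow> x \<in> points Y \<longrightarrow> f (act Y n x) = act Z n (f x)}"

definition odd_terminal :: "unit odd_set" where
  "odd_terminal = \<lparr>points = {()}, act = (\<lambda>n x. x)\<rparr>"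

definition frobenius_odd_set :: "('a, 'm) f12_alg_scheme \<Rightarrow> 'a odd_set" where
  "frobenius_odd_set A = \<lparr>points = carrier A, act = (\<lambda>n s. s [^]\<^bsub>A\<^esub> n)\<rparr>"

text \<open>Morphisms in the topos from the terminal object to the sections over the whole space. The monoid
  acts trivially on the space, hence by \<open>Fr\<^sub>n\<close> on the sections over each open set.\<close>

definition topos_global_sections :: "'p topology \<Rightarrow> ('p, 'a) presheaf \<Rightarrow> (unit \<Rightarrow> 'a) f12_alg" where
  "topos_global_sections X F =
     (let A = sect F (topspace X) in
      \<lparr>carrier = odd_hom odd_terminal (frobenius_odd_set A),
       mult = (\<lambda>f g u. f u \<otimes>\<^bsub>A\<^esub> g u),
       one = (\<lambda>u. \<one>\<^bsub>A\<^esub>),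
       pt = (\<lambda>u. pt A),
       str = (\<lambda>c u. str A c)\<rparr>)"

lemma odd_hom_terminal_fixed:
  "bij_betw (\<lambda>f. f ()) (odd_hom odd_terminal Y) {y \<in> points Y. \<forall>n. odd n \<longrightarrow> act Y n y = y}"
proof (rule bij_betw_byWitness[where f' = "\<lambda>y u. y"])
qed (auto simp: odd_hom_def odd_terminal_def PiE_def extensional_def)

lemma is_odd_set_frobenius:
  assumes "f12_algebra A"
  shows "is_odd_set (frobenius_odd_set A)"
proof -
  interpret f12_algebra A by fact
  show ?thesis
    by (simp add: is_odd_set_def frobenius_odd_set_def nat_pow_pow mult.commute)
qed

lemma f12_hom_frobenius:
  assumes "f12_algebra A" "f12_algebra B" "f \<in> f12_hom A B"
  shows "restrict f (carrier A) \<in> odd_hom (frobenius_odd_set A) (frobenius_odd_set B)"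
proof -
  interpret A: f12_algebra A by fact
  interpret B: f12_algebra B by fact
  have f: "f \<in> carrier A \<rightarrow> carrier B" "f \<one>\<^bsub>A\<^esub> = \<one>\<^bsub>B\<^esub>"
    and m: "\<And>x y. x \<in> carrier A \<Longrightarrow> y \<in> carrier A \<Longrightarrow> f (x \<otimes>\<^bsub>A\<^esub> y) = f x \<otimes>\<^bsub>B\<^esub> f y"
    using assms(3) by (auto simp: f12_hom_def hom_def)
  have "f (x [^]\<^bsub>A\<^esub> n) = f x [^]\<^bsub>B\<^esub> n" if "x \<in> carrier A" for x and n :: nat
    using that by (induction n) (auto simp: f m)
  then show ?thesis
    using f by (auto simp: odd_hom_def frobenius_odd_set_def)
qed

section \<open>The finite component\<close>

definition zariski_topology :: "('r, 'm) ring_scheme \<Rightarrow> 'r set topology" where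
  "zariski_topology R =
     topology (\<lambda>U. \<exists>S. S \<subseteq> carrier R \<and> U = {P. primeideal P R \<and> \<not> S \<subseteq> P})"

lemma istopology_zariski:
  "istopology (\<lambda>U. \<exists>S. S \<subseteq> carrier R \<and> U = {P. primeideal P R \<and> \<not> S \<subseteq> P})"
  unfolding istopology_def
proof (intro conjI allI impI)
  fix U V
  assume "\<exists>S. S \<subseteq> carrier R \<and> U = {P. primeideal P R \<and> \<not> S \<subseteq> P}"
    and "\<exists>S. S \<subseteq> carrier R \<and> V = {P. primeideal P R \<and> \<not> S \<subseteq> P}"
  then obtain S T where S: "S \<subseteq> carrier R" "U = {P. primeideal P R \<and> \<not> S \<subseteq> P}"
    and T: "T \<subseteq> carrier R" "V = {P. primeideal P R \<and> \<not> T \<subseteq> P}"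
    by blast
  have "(\<not> S \<subseteq> P \<and> \<not> T \<subseteq> P) \<longleftrightarrow> \<not> {s \<otimes>\<^bsub>R\<^esub> t | s t. s \<in> S \<and> t \<in> T} \<inter> carrier R \<subseteq> P"
    if "primeideal P R" for P
  proof -
    interpret primeideal P R by fact
    show ?thesis
    proof
      assume "\<not> S \<subseteq> P \<and> \<not> T \<subseteq> P"
      then obtain s t where st: "s \<in> S" "t \<in> T" "s \<notin> P" "t \<notin> P"
        by blast
      then have "s \<in> carrier R" "t \<in> carrier R"
        using S(1) T(1) by blast+
      then have "s \<otimes>\<^bsub>R\<^esub> t \<in> carrier R" "s \<otimes>\<^bsub>R\<^esub> t \<notin> P"
        using I_prime[of s t] st by auto
      then show "\<not> {s \<otimes>\<^bsub>R\<^esub> t | s t. s \<in> S \<and> t \<in> T} \<inter> carrier R \<subseteq> P"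
        using st by blast
    next
      assume "\<not> {s \<otimes>\<^bsub>R\<^esub> t | s t. s \<in> S \<and> t \<in> T} \<inter> carrier R \<subseteq> P"
      then obtain s t where st: "s \<in> S" "t \<in> T" "s \<otimes>\<^bsub>R\<^esub> t \<notin> P"
        by blast
      then have "s \<in> carrier R" "t \<in> carrier R"
        using S(1) T(1) by blast+
      then have "s \<notin> P" "t \<notin> P"
        using I_l_closed[of t s] I_r_closed[of s t] st(3) by auto
      then show "\<not> S \<subseteq> P \<and> \<not> T \<subseteq> P"
        using st by blast
    qed
  qed
  then have "U \<inter> V = {P. primeideal P R \<and> \<not> {s \<otimes>\<^bsub>R\<^esub> t | s t. s \<in> S \<and> t \<in> T} \<inter> carrier R \<subseteq> P}"
    using S(2) T(2) by blast
  then show "\<exists>S. S \<subseteq> carrier R \<and> U \<inter> V = {P. primeideal P R \<and> \<not> S \<subseteq> P}"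
    by (intro exI[of _ "{s \<otimes>\<^bsub>R\<^esub> t | s t. s \<in> S \<and> t \<in> T} \<inter> carrier R"]) simp
next
  fix \<K>
  assume "\<forall>K\<in>\<K>. \<exists>S. S \<subseteq> carrier R \<and> K = {P. primeideal P R \<and> \<not> S \<subseteq> P}"
  then obtain S where S: "\<And>K. K \<in> \<K> \<Longrightarrow> S K \<subseteq> carrier R"
    "\<And>K. K \<in> \<K> \<Longrightarrow> K = {P. primeideal P R \<and> \<not> S K \<subseteq> P}"
    by metis
  have "\<Union>\<K> = {P. primeideal P R \<and> \<not> (\<Union>K\<in>\<K>. S K) \<subseteq> P}"
    using S(2) by blast
  then show "\<exists>S. S \<subseteq> carrier R \<and> \<Union>\<K> = {P. primeideal P R \<and> \<not> S \<subseteq> P}"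
    using S(1) by (intro exI[of _ "\<Union>K\<in>\<K>. S K"]) auto
qed

abbreviation SpecZ :: "int set topology" where
  "SpecZ \<equiv> zariski_topology \<Z>"

definition eta_fin :: "int set" where
  "eta_fin = {0}"

definition closed_pt :: "nat \<Rightarrow> int set" where
  "closed_pt p = Idl\<^bsub>\<Z>\<^esub> {int p}"

text \<open>A totally ordered torsion-free abelian group of rank one, written multiplicatively, given by the
  submonoid P of its non-negative elements.\<close>

definition ordered_rank_one_group :: "('h, 'm) monoid_scheme \<Rightarrow> 'h set \<Rightarrow> bool" where
  "ordered_rank_one_group H P \<longleftrightarrow>
     comm_group H \<and>
     (\<forall>h\<in>carrier H. \<forall>n>0::nat. h [^]\<^bsub>H\<^esub> n = \<one>\<^bsub>H\<^esub> \<longrightarrow> h = \<one>\<^bsub>H\<^esub>) \<and>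
     (\<exists>h\<in>carrier H. h \<noteq> \<one>\<^bsub>H\<^esub>) \<and>
     (\<forall>h\<in>carrier H. \<forall>k\<in>carrier H. \<exists>(m::int) (n::int). (m, n) \<noteq> (0, 0) \<and> h [^]\<^bsub>H\<^esub> m = k [^]\<^bsub>H\<^esub> n) \<and>
     submonoid P H \<and>
     (\<forall>h\<in>carrier H. h \<in> P \<or> inv\<^bsub>H\<^esub> h \<in> P) \<and>
     (\<forall>h\<in>P. inv\<^bsub>H\<^esub> h \<in> P \<longrightarrow> h = \<one>\<^bsub>H\<^esub>)"

definition is_finite_structure_sheaf ::
  "(nat \<Rightarrow> 'h monoid) \<Rightarrow> (nat \<Rightarrow> 'h set) \<Rightarrow> (int set, 'a) presheaf \<Rightarrow> bool" where
  "is_finite_structure_sheaf H Hpos F \<longleftrightarrow>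
     f12_sheaf SpecZ F \<and>
     f12_iso (stalk SpecZ F eta_fin) F12 \<noteq> {} \<and>
     (\<forall>p. prime p \<longrightarrow>
        f12_iso (stalk SpecZ F (closed_pt p)) (F12_monoid_algebra ((H p)\<lparr>carrier := Hpos p\<rparr>)) \<noteq> {})"

section \<open>The archimedean component\<close>

datatype arch_pt = Plus | Minus | Eta

definition arch_topology :: "arch_pt topology" where
  "arch_topology = topology (\<lambda>U. U \<in> {{}, {Eta}, {Plus, Eta}, {Minus, Eta}, {Plus, Minus, Eta}})"

lemma arch_opens_iff:
  "U \<in> {{}, {Eta}, {Plus, Eta}, {Minus, Eta}, {Plus, Minus, Eta}} \<longleftrightarrow> U = {} \<or> Eta \<in> U"
proof
  assume "U = {} \<or> Eta \<in> U"
  moreover have "U = (if Plus \<in> U then {Plus} else {}) \<union> (if Minus \<in> U then {Minus} else {})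
      \<union> (if Eta \<in> U then {Eta} else {})"
  proof (rule Set.set_eqI)
    fix x
    show "x \<in> U \<longleftrightarrow> x \<in> (if Plus \<in> U then {Plus} else {}) \<union> (if Minus \<in> U then {Minus} else {})
      \<union> (if Eta \<in> U then {Eta} else {})"
      by (cases x) auto
  qed
  ultimately show "U \<in> {{}, {Eta}, {Plus, Eta}, {Minus, Eta}, {Plus, Minus, Eta}}"
    by (cases "Plus \<in> U"; cases "Minus \<in> U"; cases "Eta \<in> U") auto
qed auto

lemma istopology_arch:
  "istopology (\<lambda>U. U \<in> {{}, {Eta}, {Plus, Eta}, {Minus, Eta}, {Plus, Minus, Eta}})"
  unfolding arch_opens_iff istopology_def by blast

text \<open>Each point x has a smallest open neighbourhood, namely \<open>\<Omega>\<^sub>+\<close>, \<open>\<Omega>\<^sub>-\<close> or \<open>\<Omega>\<close>. The families below are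
  indexed by x and refer to this neighbourhood. The monomial \<open>Mon a (n, k)\<close> stands for
  \<open>\<epsilon>\<^sup>a T\<^sup>n J\<^sup>k\<close>, where J is \<open>J\<^sub>+\<close>, \<open>J\<^sub>-\<close> or J, before the relation \<open>J\<^sup>2 = \<epsilon>\<close> is imposed.\<close>

fun T_exponents :: "arch_pt \<Rightarrow> int set" where
  "T_exponents Plus = {0..}"
| "T_exponents Minus = {..0}"
| "T_exponents Eta = UNIV"

definition TJ_monoid :: "arch_pt \<Rightarrow> (int \<times> nat) monoid" where
  "TJ_monoid x =
     \<lparr>carrier = T_exponents x \<times> UNIV, mult = (\<lambda>(n, k) (m, l). (n + m, k + l)), one = (0, 0)\<rparr>"

definition J_relation :: "(int \<times> nat) monomial rel" where
  "J_relation = {(Mon False (0, 2), Mon True (0, 0))}"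

definition arch_cong :: "arch_pt \<Rightarrow> (int \<times> nat) monomial rel" where
  "arch_cong x = f12_cong (F12_monoid_algebra (TJ_monoid x)) J_relation"

definition arch_alg :: "arch_pt \<Rightarrow> (int \<times> nat) monomial set f12_alg" where
  "arch_alg x = f12_quot (F12_monoid_algebra (TJ_monoid x)) J_relation"

text \<open>The restriction to \<open>\<Omega>\<close> and the maps \<open>\<alpha>\<^sup>*\<close>, \<open>\<alpha>\<^sub>+\<^sup>*\<close>, \<open>\<alpha>\<^sub>-\<^sup>*\<close> are given on monomials by extending
  multiplicatively their prescribed values on T and J. They act on a class C of the quotient by
  taking the class of the image of a representative.\<close>

fun res_monomial :: "arch_pt \<Rightarrow> (int \<times> nat) monomial \<Rightarrow> (int \<times> nat) monomial" where
  "res_monomial x Nul = Nul"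
| "res_monomial Plus (Mon a (n, k)) = Mon a (n, k)"
| "res_monomial Minus (Mon a (n, k)) = Mon (a \<noteq> odd k) (n, k)"
| "res_monomial Eta (Mon a (n, k)) = Mon a (n, k)"

definition arch_res :: "arch_pt \<Rightarrow> (int \<times> nat) monomial set \<Rightarrow> (int \<times> nat) monomial set" where
  "arch_res x C = arch_cong Eta `` (res_monomial x ` C)"

fun alpha_pt :: "arch_pt \<Rightarrow> arch_pt" where
  "alpha_pt Plus = Minus"
| "alpha_pt Minus = Plus"
| "alpha_pt Eta = Eta"

fun alpha_monomial :: "arch_pt \<Rightarrow> (int \<times> nat) monomial \<Rightarrow> (int \<times> nat) monomial" where
  "alpha_monomial x Nul = Nul"
| "alpha_monomial Eta (Mon a (n, k)) = Mon (a \<noteq> (odd n \<noteq> odd k)) (- n, k)"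
| "alpha_monomial Plus (Mon a (n, k)) = Mon (a \<noteq> odd n) (- n, k)"
| "alpha_monomial Minus (Mon a (n, k)) = Mon (a \<noteq> odd n) (- n, k)"

text \<open>The map from the algebra at \<open>alpha_pt x\<close> to the algebra at x.\<close>

definition arch_alpha :: "arch_pt \<Rightarrow> (int \<times> nat) monomial set \<Rightarrow> (int \<times> nat) monomial set" where
  "arch_alpha x C = arch_cong x `` (alpha_monomial x ` C)"

text \<open>A section over U is a family of elements of the algebras of the smallest neighbourhoods of the
  points of U, compatible with restriction to \<open>\<Omega>\<close>. This is the sheaf determined by its values on
  \<open>\<Omega>\<^sub>+\<close>, \<open>\<Omega>\<^sub>-\<close>, \<open>\<Omega>\<close>.\<close>

definition O_arch :: "(arch_pt, arch_pt \<Rightarrow> (int \<times> nat) monomial set) presheaf" where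
  "O_arch =
     \<lparr>sect = (\<lambda>U.
        \<lparr>carrier = {s \<in> (\<Pi>\<^sub>E x\<in>U. carrier (arch_alg x)). \<forall>x\<in>U. s Eta = arch_res x (s x)},
         mult = (\<lambda>s t. \<lambda>x\<in>U. s x \<otimes>\<^bsub>arch_alg x\<^esub> t x),
         one = (\<lambda>x\<in>U. \<one>\<^bsub>arch_alg x\<^esub>),
         pt = (\<lambda>x\<in>U. pt (arch_alg x)),
         str = (\<lambda>c. \<lambda>x\<in>U. str (arch_alg x) c)\<rparr>),
      rest = (\<lambda>U V s. restrict s V)\<rparr>"

definition alpha_star ::
  "arch_pt set \<Rightarrow> (arch_pt \<Rightarrow> (int \<times> nat) monomial set) \<Rightarrow> (arch_pt \<Rightarrow> (int \<times> nat) monomial set)" where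
  "alpha_star U s = (\<lambda>x\<in>U. arch_alpha x (s (alpha_pt x)))"

definition alpha_orbit :: "arch_pt \<Rightarrow> arch_pt set" where
  "alpha_orbit x = {x, alpha_pt x}"

definition C_inf :: "arch_pt set topology" where
  "C_inf = topology (\<lambda>V. V \<subseteq> range alpha_orbit \<and> openin arch_topology (alpha_orbit -` V))"

lemma istopology_C_inf:
  "istopology (\<lambda>V. V \<subseteq> range alpha_orbit \<and> openin arch_topology (alpha_orbit -` V))"
  unfolding istopology_def by (auto simp: vimage_Union intro!: openin_Int)

definition eta_inf :: "arch_pt set" where
  "eta_inf = alpha_orbit Eta"

definition O_inf :: "(arch_pt set, arch_pt \<Rightarrow> (int \<times> nat) monomial set) presheaf" where
  "O_inf =
     \<lparr>sect = (\<lambda>V. let U = alpha_orbit -` V in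
        (sect O_arch U)\<lparr>carrier := {s \<in> carrier (sect O_arch U). alpha_star U s = s}\<rparr>),
      rest = (\<lambda>V W. rest O_arch (alpha_orbit -` V) (alpha_orbit -` W))\<rparr>"

section \<open>The global curve\<close>

text \<open>Pushout of topological spaces along the inclusions of a point: the points are the classes of the
  disjoint union under the identification of x with y, and a set is open iff its preimages in
  both spaces are open.\<close>

definition glue_rel :: "'p \<Rightarrow> 'q \<Rightarrow> ('p + 'q) rel" where
  "glue_rel x y = Id \<union> {(Inl x, Inr y), (Inr y, Inl x)}"

definition glue_inl :: "'p \<Rightarrow> 'q \<Rightarrow> 'p \<Rightarrow> ('p + 'q) set" where
  "glue_inl x y z = glue_rel x y `` {Inl z}"

definition glue_inr :: "'p \<Rightarrow> 'q \<Rightarrow> 'q \<Rightarrow> ('p + 'q) set" where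
  "glue_inr x y z = glue_rel x y `` {Inr z}"

definition glued_topology :: "'p topology \<Rightarrow> 'p \<Rightarrow> 'q topology \<Rightarrow> 'q \<Rightarrow> ('p + 'q) set topology" where
  "glued_topology X x Y y = topology (\<lambda>U.
     U \<subseteq> glue_inl x y ` topspace X \<union> glue_inr x y ` topspace Y \<and>
     openin X {z \<in> topspace X. glue_inl x y z \<in> U} \<and>
     openin Y {z \<in> topspace Y. glue_inr x y z \<in> U})"

lemma istopology_glued:
  "istopology (\<lambda>U.
     U \<subseteq> glue_inl x y ` topspace X \<union> glue_inr x y ` topspace Y \<and>
     openin X {z \<in> topspace X. glue_inl x y z \<in> U} \<and>
     openin Y {z \<in> topspace Y. glue_inr x y z \<in> U})"
proof -
  let ?L = "\<lambda>U. U \<subseteq> glue_inl x y ` topspace X \<union> glue_inr x y ` topspace Y \<and>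
     openin X {z \<in> topspace X. glue_inl x y z \<in> U} \<and>
     openin Y {z \<in> topspace Y. glue_inr x y z \<in> U}"
  have int: "{z \<in> A. f z \<in> S \<inter> T} = {z \<in> A. f z \<in> S} \<inter> {z \<in> A. f z \<in> T}"
    and un: "{z \<in> A. f z \<in> \<Union>\<K>} = (\<Union>K\<in>\<K>. {z \<in> A. f z \<in> K})"
    for A :: "'x set" and f :: "'x \<Rightarrow> 'y" and S T \<K>
    by auto
  have "?L (S \<inter> T)" if "?L S" "?L T" for S T
    using that unfolding int by (auto intro: openin_Int)
  moreover have "?L (\<Union>\<K>)" if "\<forall>K\<in>\<K>. ?L K" for \<K>
  proof -
    have "openin X (\<Union>K\<in>\<K>. {z \<in> topspace X. glue_inl x y z \<in> K})"
      "openin Y (\<Union>K\<in>\<K>. {z \<in> topspace Y. glue_inr x y z \<in> K})"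
      using that by (auto intro!: openin_Union)
    then show ?thesis
      using that unfolding un by (simp add: Union_least)
  qed
  ultimately show ?thesis
    unfolding istopology_def by simp
qed

definition curve :: "(int set + arch_pt set) set topology" where
  "curve = glued_topology SpecZ eta_fin C_inf eta_inf"

definition fin_part :: "(int set + arch_pt set) set set \<Rightarrow> int set set" where
  "fin_part U = {z \<in> topspace SpecZ. glue_inl eta_fin eta_inf z \<in> U}"

definition inf_part :: "(int set + arch_pt set) set set \<Rightarrow> arch_pt set set" where
  "inf_part U = {z \<in> topspace C_inf. glue_inr eta_fin eta_inf z \<in> U}"

text \<open>The fibre product of the sections of the two components over their generic stalks, each of them
  identified with {0, 1, epsilon} by its structure map. For empty U there is no condition.\<close>

definition O_curve ::
  "(int set, 'a) presheaf \<Rightarrow>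
   ((int set + arch_pt set) set, 'a \<times> (arch_pt \<Rightarrow> (int \<times> nat) monomial set)) presheaf" where
  "O_curve F =
     \<lparr>sect = (\<lambda>U. let A = sect F (fin_part U); B = sect O_inf (inf_part U) in
        \<lparr>carrier = {(s, t). s \<in> carrier A \<and> t \<in> carrier B \<and>
           (U \<noteq> {} \<longrightarrow> (\<exists>c. germ SpecZ F eta_fin (fin_part U) s = str (stalk SpecZ F eta_fin) c \<and>
                          germ C_inf O_inf eta_inf (inf_part U) t = str (stalk C_inf O_inf eta_inf) c))},
         mult = (\<lambda>(s, t) (s', t'). (s \<otimes>\<^bsub>A\<^esub> s', t \<otimes>\<^bsub>B\<^esub> t')),
         one = (\<one>\<^bsub>A\<^esub>, \<one>\<^bsub>B\<^esub>),
         pt = (pt A, pt B),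
         str = (\<lambda>c. (str A c, str B c))\<rparr>),
      rest = (\<lambda>U V (s, t). (rest F (fin_part U) (fin_part V) s, rest O_inf (inf_part U) (inf_part V) t))\<rparr>"

end

theory Submission
  imports Defs
begin

text \<open>A global section is a pair \<open>(s, t)\<close> whose germs at the generic point are the same constant c.
  If \<open>s\<^sup>3 = s\<close>, then the germ of s at a prime p is zero or \<open>\<epsilon>\<^sup>a T\<^sup>h\<close> with \<open>h + h = 0\<close>, hence a
  constant since \<open>H\<^sub>p\<close> is torsion free. The generic point lies in every neighbourhood of p, so this
  constant is c; thus s and the constant section c have the same germs everywhere and agree. On the
  archimedean side the restriction maps to the generic point are injective, because modulo
  \<open>J\<^sup>2 = \<epsilon>\<close> every monomial has a unique normal form \<open>\<epsilon>\<^sup>a T\<^sup>n J\<^sup>k\<close> with k in {0, 1}; so there t is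
  constant without any use of the Frobenius action.\<close>

section \<open>Germs\<close>

context f12_presheaf
begin

lemma rest_closed:
  "openin X U \<Longrightarrow> openin X V \<Longrightarrow> V \<subseteq> U \<Longrightarrow> s \<in> carrier (sect F U) \<Longrightarrow>
    rest F U V s \<in> carrier (sect F V)"
  using rest_hom[of U V] by (auto simp: f12_hom_def hom_def)

lemma rest_mult:
  "openin X U \<Longrightarrow> openin X V \<Longrightarrow> V \<subseteq> U \<Longrightarrow> s \<in> carrier (sect F U) \<Longrightarrow> t \<in> carrier (sect F U) \<Longrightarrow>
    rest F U V (s \<otimes>\<^bsub>sect F U\<^esub> t) = rest F U V s \<otimes>\<^bsub>sect F V\<^esub> rest F U V t"
  using rest_hom[of U V] by (auto simp: f12_hom_def hom_def)

lemma mult_closed: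
  "openin X U \<Longrightarrow> s \<in> carrier (sect F U) \<Longrightarrow> t \<in> carrier (sect F U) \<Longrightarrow>
    s \<otimes>\<^bsub>sect F U\<^esub> t \<in> carrier (sect F U)"
  using sect_alg[of U] by (simp add: f12_algebra_def comm_monoid_def monoid.m_closed)

lemma str_closed: "openin X U \<Longrightarrow> str (sect F U) c \<in> carrier (sect F U)"
  using f12_algebra.str_hom[OF sect_alg] by (auto simp: hom_def F12_def)

lemma local_sections_iff:
  "(U, s) \<in> local_sections X F x \<longleftrightarrow> openin X U \<and> x \<in> U \<and> s \<in> carrier (sect F U)"
  by (simp add: local_sections_def)

lemma germ_relI:
  "(U, s) \<in> local_sections X F x \<Longrightarrow> (V, t) \<in> local_sections X F x \<Longrightarrow> openin X W \<Longrightarrow> x \<in> W \<Longrightarrow>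
    W \<subseteq> U \<Longrightarrow> W \<subseteq> V \<Longrightarrow> rest F U W s = rest F V W t \<Longrightarrow> ((U, s), (V, t)) \<in> germ_rel X F x"
  by (auto simp: germ_rel_def)

lemma germ_relE:
  assumes "((U, s), (V, t)) \<in> germ_rel X F x"
  obtains W where "openin X W" "x \<in> W" "W \<subseteq> U" "W \<subseteq> V" "rest F U W s = rest F V W t"
    "(U, s) \<in> local_sections X F x" "(V, t) \<in> local_sections X F x"
  using assms by (auto simp: germ_rel_def)

lemma rest_eq_smaller:
  assumes "rest F U W s = rest F V W t" "openin X U" "openin X V" "openin X W" "openin X W'"
    "W \<subseteq> U" "W \<subseteq> V" "W' \<subseteq> W" "s \<in> carrier (sect F U)" "t \<in> carrier (sect F V)"
  shows "rest F U W' s = rest F V W' t"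
  using assms rest_comp[of U W W' s] rest_comp[of V W W' t] by simp

text \<open>Transitivity shrinks to the intersection of the two witnessing neighbourhoods, to which
  \<open>rest_eq_smaller\<close> carries both equalities.\<close>

lemma equiv_germ_rel: "equiv (local_sections X F x) (germ_rel X F x)"
proof (rule equivI)
  show "germ_rel X F x \<subseteq> local_sections X F x \<times> local_sections X F x"
    by (auto simp: germ_rel_def)
  show "refl_on (local_sections X F x) (germ_rel X F x)"
    by (force simp: germ_rel_def refl_on_def local_sections_def)
  show "sym (germ_rel X F x)"
    unfolding germ_rel_def by (rule symI) (clarsimp, metis)
  show "trans (germ_rel X F x)"
  proof (rule transI, clarify)
    fix U s V t V' t'
    assume "((U, s), (V, t)) \<in> germ_rel X F x" "((V, t), (V', t')) \<in> germ_rel X F x"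
    then obtain W W' where W: "openin X W" "x \<in> W" "W \<subseteq> U" "W \<subseteq> V" "rest F U W s = rest F V W t"
      "(U, s) \<in> local_sections X F x" "(V, t) \<in> local_sections X F x"
      and W': "openin X W'" "x \<in> W'" "W' \<subseteq> V" "W' \<subseteq> V'" "rest F V W' t = rest F V' W' t'"
      "(V', t') \<in> local_sections X F x"
      by (elim germ_relE)
    have "rest F U (W \<inter> W') s = rest F V (W \<inter> W') t"
      by (rule rest_eq_smaller[of U W s V t])
        (use W W' in \<open>auto simp: local_sections_iff intro: openin_Int\<close>)
    also have "\<dots> = rest F V' (W \<inter> W') t'"
      by (rule rest_eq_smaller[of V W' t V' t'])
        (use W W' in \<open>auto simp: local_sections_iff intro: openin_Int\<close>)
    finally show "((U, s), (V', t')) \<in> germ_rel X F x"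
      by (intro germ_relI[where W = "W \<inter> W'"]) (use W W' in \<open>auto intro: openin_Int\<close>)
  qed
qed

lemma germ_eq_iff:
  assumes "openin X U" "openin X V" "x \<in> U" "x \<in> V" "s \<in> carrier (sect F U)" "t \<in> carrier (sect F V)"
  shows "germ X F x U s = germ X F x V t \<longleftrightarrow>
    (\<exists>W. openin X W \<and> x \<in> W \<and> W \<subseteq> U \<inter> V \<and> rest F U W s = rest F V W t)"
proof -
  have "germ X F x U s = germ X F x V t \<longleftrightarrow> ((U, s), (V, t)) \<in> germ_rel X F x"
    unfolding germ_def
    by (rule eq_equiv_class_iff[OF equiv_germ_rel]) (use assms in \<open>auto simp: local_sections_iff\<close>)
  then show ?thesis
    using assms by (simp add: germ_rel_def local_sections_iff)
qed

lemma germ_closed: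
  "openin X U \<Longrightarrow> x \<in> U \<Longrightarrow> s \<in> carrier (sect F U) \<Longrightarrow> germ X F x U s \<in> carrier (stalk X F x)"
  by (simp add: germ_def stalk_def local_sections_iff quotientI)

text \<open>\<open>stalk\<close> multiplies two classes through all pairs of representatives. Every
  such product has the same germ as the product over \<open>U\<close>, so a single class
  results.\<close>

lemma germ_mult:
  assumes U: "openin X U" "x \<in> U" and s: "s \<in> carrier (sect F U)" and t: "t \<in> carrier (sect F U)"
  shows "germ X F x U s \<otimes>\<^bsub>stalk X F x\<^esub> germ X F x U t = germ X F x U (s \<otimes>\<^bsub>sect F U\<^esub> t)"
proof -
  let ?R = "germ_rel X F x"
  let ?Q = "{(V \<inter> V', rest F V (V \<inter> V') v \<otimes>\<^bsub>sect F (V \<inter> V')\<^esub> rest F V' (V \<inter> V') v') | V V' v v'.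
    (V, v) \<in> germ X F x U s \<and> (V', v') \<in> germ X F x U t}"
  have related: "((U, s \<otimes>\<^bsub>sect F U\<^esub> t), q) \<in> ?R" if q: "q \<in> ?Q" for q
  proof -
    obtain V V' v v' where q: "q = (V \<inter> V', rest F V (V \<inter> V') v \<otimes>\<^bsub>sect F (V \<inter> V')\<^esub> rest F V' (V \<inter> V') v')"
      and "((U, s), (V, v)) \<in> ?R" "((U, t), (V', v')) \<in> ?R"
      using q by (auto simp: germ_def)
    then obtain W W' where W: "openin X W" "x \<in> W" "W \<subseteq> U" "W \<subseteq> V" "rest F U W s = rest F V W v"
      "openin X V" "v \<in> carrier (sect F V)"
      and W': "openin X W'" "x \<in> W'" "W' \<subseteq> U" "W' \<subseteq> V'" "rest F U W' t = rest F V' W' v'"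
      "openin X V'" "v' \<in> carrier (sect F V')"
      by (auto elim!: germ_relE simp: local_sections_iff)
    \<comment> \<open>A neighbourhood of \<open>x\<close> on which \<open>v\<close> agrees with
      \<open>s\<close> and \<open>v'\<close> agrees with \<open>t\<close>.\<close>
    define N where "N = W \<inter> W'"
    have N: "openin X N" "x \<in> N" "N \<subseteq> U" "N \<subseteq> V \<inter> V'" "N \<subseteq> W" "N \<subseteq> W'"
      using W W' by (auto simp: N_def intro: openin_Int)
    have VV: "openin X (V \<inter> V')" "x \<in> V \<inter> V'"
      using W W' by (auto intro: openin_Int)
    have c: "rest F V (V \<inter> V') v \<in> carrier (sect F (V \<inter> V'))"
      "rest F V' (V \<inter> V') v' \<in> carrier (sect F (V \<inter> V'))"
      using W W' VV by (auto intro: rest_closed)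
    have "rest F U N (s \<otimes>\<^bsub>sect F U\<^esub> t) = rest F U N s \<otimes>\<^bsub>sect F N\<^esub> rest F U N t"
      using U N s t by (intro rest_mult) auto
    also have "rest F U N s = rest F V N v"
      by (rule rest_eq_smaller[of U W s V v]) (use U W N s in auto)
    also have "\<dots> = rest F (V \<inter> V') N (rest F V (V \<inter> V') v)"
      using W W' VV N by (simp add: rest_comp)
    also have "rest F U N t = rest F V' N v'"
      by (rule rest_eq_smaller[of U W' t V' v']) (use U W' N t in auto)
    also have "\<dots> = rest F (V \<inter> V') N (rest F V' (V \<inter> V') v')"
      using W W' VV N by (simp add: rest_comp)
    also have "rest F (V \<inter> V') N (rest F V (V \<inter> V') v) \<otimes>\<^bsub>sect F N\<^esub> rest F (V \<inter> V') N (rest F V' (V \<inter> V') v') =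
      rest F (V \<inter> V') N (rest F V (V \<inter> V') v \<otimes>\<^bsub>sect F (V \<inter> V')\<^esub> rest F V' (V \<inter> V') v')"
      using VV N c by (simp add: rest_mult)
    finally show ?thesis
      unfolding q using N U VV c s t
      by (intro germ_relI[where W = N]) (auto simp: local_sections_iff mult_closed)
  qed
  have "(U, s) \<in> germ X F x U s" "(U, t) \<in> germ X F x U t"
    unfolding germ_def
    by (rule equiv_class_self[OF equiv_germ_rel]; use assms in \<open>simp add: local_sections_iff\<close>)+
  \<comment> \<open>Restriction from \<open>U\<close> to itself is the identity, so the pair of
    representatives over \<open>U\<close> puts the wanted product into \<open>?Q\<close>.\<close>
  moreover have "(U, s \<otimes>\<^bsub>sect F U\<^esub> t) = (U \<inter> U, rest F U (U \<inter> U) s \<otimes>\<^bsub>sect F (U \<inter> U)\<^esub> rest F U (U \<inter> U) t)"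
    using assms by (simp add: rest_id)
  ultimately have "(U, s \<otimes>\<^bsub>sect F U\<^esub> t) \<in> ?Q"
    by blast
  then have "?R `` ?Q = germ X F x U (s \<otimes>\<^bsub>sect F U\<^esub> t)"
    using related equiv_germ_rel[of x] unfolding germ_def equiv_def
    by (blast dest: transD)
  then show ?thesis
    by (simp add: stalk_def)
qed

end

text \<open>Equal germs yield a cover of \<open>U\<close> by open sets on which the two restrictions
  coincide; \<open>separated\<close> then applies to this cover.\<close>

lemma (in f12_sheaf) eq_if_germs_eq:
  assumes U: "openin X U" and s: "s \<in> carrier (sect F U)" and t: "t \<in> carrier (sect F U)"
    and germs: "\<And>x. x \<in> U \<Longrightarrow> germ X F x U s = germ X F x U t"
  shows "s = t"
proof -
  define \<U> where "\<U> = {W. openin X W \<and> W \<subseteq> U \<and> rest F U W s = rest F U W t}"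
  have "\<exists>W\<in>\<U>. x \<in> W" if "x \<in> U" for x
    using germs[OF that] germ_eq_iff[OF U U that that s t] by (auto simp: \<U>_def)
  then have "\<Union>\<U> = U"
    by (auto simp: \<U>_def)
  then show ?thesis
    using separated[of \<U> s t] s t by (auto simp: \<U>_def)
qed

section \<open>The topology of the spectrum of the integers\<close>

lemma openin_zariski:
  "openin (zariski_topology R) U \<longleftrightarrow> (\<exists>S. S \<subseteq> carrier R \<and> U = {P. primeideal P R \<and> \<not> S \<subseteq> P})"
  unfolding zariski_topology_def topology_inverse'[OF istopology_zariski] by (rule refl)

lemma primeideal_one_notin:
  assumes "primeideal P R"
  shows "\<one>\<^bsub>R\<^esub> \<notin> P"
proof -
  interpret primeideal P R by fact
  show ?thesis
    using one_imp_carrier I_notcarr by blast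
qed

lemma topspace_zariski:
  assumes "ring R"
  shows "topspace (zariski_topology R) = {P. primeideal P R}"
proof -
  have "openin (zariski_topology R) {P. primeideal P R}"
    unfolding openin_zariski using primeideal_one_notin[of _ R] ring.ring_simprules(6)[OF assms]
    by (intro exI[of _ "{\<one>\<^bsub>R\<^esub>}"]) auto
  moreover have "U \<subseteq> {P. primeideal P R}" if "openin (zariski_topology R) U" for U
    using that by (auto simp: openin_zariski)
  ultimately show ?thesis
    by (meson openin_subset openin_topspace subset_antisym)
qed

lemma topspace_SpecZ: "topspace SpecZ = {P. primeideal P \<Z>}"
  by (rule topspace_zariski) (rule int.ring_axioms)

lemma primeideal_eta_fin: "primeideal eta_fin \<Z>"
  using int.zeroprimeideal by (simp add: eta_fin_def)

text \<open>Every prime ideal contains 0, so a set that is not contained in some prime ideal has a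
  nonzero element and is not contained in \<open>{0}\<close> either.\<close>

lemma eta_fin_in_open:
  assumes "openin SpecZ U" "U \<noteq> {}"
  shows "eta_fin \<in> U"
proof -
  obtain S where U: "U = {P. primeideal P \<Z> \<and> \<not> S \<subseteq> P}"
    using assms(1) by (auto simp: openin_zariski)
  obtain P where P: "primeideal P \<Z>" "\<not> S \<subseteq> P"
    using U assms(2) by blast
  interpret P: primeideal P \<Z> by fact
  have "0 \<in> P"
    using P.zero_closed by simp
  then show ?thesis
    using P U primeideal_eta_fin by (auto simp: eta_fin_def)
qed

text \<open>Strong induction: a prime factor of \<open>n\<close> is split off, and by primality
  either it or the smaller cofactor lies in \<open>P\<close>.\<close>

lemma primeideal_int_contains_prime:
  assumes "primeideal P \<Z>" "n > 0" "int n \<in> P"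
  shows "\<exists>p. prime p \<and> int p \<in> P"
  using assms(2,3)
proof (induction n rule: less_induct)
  case (less n)
  interpret P: primeideal P \<Z> by fact
  have "n \<noteq> 1"
    using primeideal_one_notin[OF assms(1)] less.prems by auto
  then obtain p where p: "prime p" "p dvd n"
    using prime_factor_nat by blast
  then obtain m where m: "n = p * m"
    by blast
  then have "int p \<in> P \<or> int m \<in> P"
    using P.I_prime[of "int p" "int m"] less.prems by simp
  moreover have "0 < m" "m < n"
    using m less.prems(1) prime_gt_1_nat[OF p(1)] by auto
  ultimately show ?case
    using less.IH p(1) by blast
qed

text \<open>A nonzero prime ideal contains a prime p, and p divides each of its elements, since a
  Bezout relation would otherwise put 1 into the ideal.\<close>

lemma primeideal_int_cases:
  assumes "primeideal P \<Z>"
  obtains "P = eta_fin" | p where "prime p" "P = closed_pt p"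
proof -
  interpret P: primeideal P \<Z> by fact
  have zero: "0 \<in> P"
    using P.zero_closed by simp
  have mult: "a * b \<in> P" if "b \<in> P" for a b
    using P.I_l_closed[of b a] that by simp
  have add: "a + b \<in> P" if "a \<in> P" "b \<in> P" for a b
    using P.a_closed[of a b] that by simp
  show ?thesis
  proof (cases "P \<subseteq> {0}")
    case True
    then show ?thesis
      using that(1) zero by (auto simp: eta_fin_def)
  next
    case False
    then obtain x where x: "x \<in> P" "x \<noteq> 0"
      by blast
    \<comment> \<open>Passes from \<open>x\<close> to its absolute value, a positive element of
      \<open>P\<close>.\<close>
    then have "sgn x * x \<in> P"
      by (intro mult)
    then have "int (nat \<bar>x\<bar>) \<in> P"
      by (simp add: abs_sgn[symmetric] mult.commute)
    then obtain p where p: "prime p" "int p \<in> P"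
      using primeideal_int_contains_prime[OF assms, of "nat \<bar>x\<bar>"] x(2) by auto
    have "int p dvd y" if "y \<in> P" for y
    proof (rule ccontr)
      assume "\<not> int p dvd y"
      then have "coprime (int p) y"
        using p(1) by (simp add: prime_imp_coprime)
      then obtain a b where "a * int p + b * y = 1"
        using bezout_int[of "int p" y] by auto
      then have "1 \<in> P"
        using add[OF mult[OF p(2)] mult[OF that]] by metis
      then show False
        using primeideal_one_notin[OF assms] by simp
    qed
    then have "P = closed_pt p"
      using mult[OF p(2)] by (fastforce simp: closed_pt_def int_Idl dvd_def mult.commute)
    then show ?thesis
      using that(2) p(1) by blast
  qed
qed

section \<open>Constants on the finite component\<close>

text \<open>The structure map of \<open>F12\<close> is the identity, so \<open>f\<close> is a left
  inverse of \<open>str A\<close>.\<close>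

lemma str_injective_if_iso_F12:
  assumes "f \<in> f12_iso A F12" "str A c = str A d"
  shows "c = d"
  using assms by (auto simp: f12_iso_def f12_hom_def F12_def dest: arg_cong[where f = f])

text \<open>From \<open>h^3 = h\<close>, cancellation in the group \<open>H\<close> (the submonoid
  \<open>P\<close> need not contain inverses) leaves \<open>h^2 = 1\<close>, and \<open>H\<close> is
  torsion free. The sign is unconstrained because \<open>epsilon^(3a) = epsilon^a\<close>.\<close>

lemma cube_fixed_constant:
  assumes H: "ordered_rank_one_group H P"
    and x: "x \<in> carrier (F12_monoid_algebra (H\<lparr>carrier := P\<rparr>))"
    and cube: "monomial_mult (H\<lparr>carrier := P\<rparr>) (monomial_mult (H\<lparr>carrier := P\<rparr>) x x) x = x"
  obtains c where "x = str (F12_monoid_algebra (H\<lparr>carrier := P\<rparr>)) c"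
proof (cases x)
  case Nul
  then show ?thesis
    using that[of F0] by (simp add: F12_monoid_algebra_def)
next
  case (Mon a h)
  interpret H: comm_group H
    using H by (simp add: ordered_rank_one_group_def)
  have "P \<subseteq> carrier H"
    using H by (simp add: ordered_rank_one_group_def submonoid_def)
  then have h: "h \<in> carrier H"
    using x Mon by (auto simp: F12_monoid_algebra_def)
  have "h \<otimes>\<^bsub>H\<^esub> h \<otimes>\<^bsub>H\<^esub> h = h"
    using cube Mon by simp
  then have "h [^]\<^bsub>H\<^esub> (2::nat) = \<one>\<^bsub>H\<^esub>"
    using h H.r_cancel_one'[of h "h \<otimes>\<^bsub>H\<^esub> h"] by (simp add: numeral_2_eq_2)
  then have "h = \<one>\<^bsub>H\<^esub>"
    using H h unfolding ordered_rank_one_group_def by (metis zero_less_numeral)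
  then show ?thesis
    using that[of "if a then Feps else F1"] Mon by (simp add: F12_monoid_algebra_def)
qed

lemma finite_section_constant:
  assumes H: "\<And>p. prime p \<Longrightarrow> ordered_rank_one_group (H p) (Hpos p)"
    and F: "is_finite_structure_sheaf H Hpos F"
    and s: "s \<in> carrier (sect F (topspace SpecZ))"
    and cube: "s \<otimes>\<^bsub>sect F (topspace SpecZ)\<^esub> s \<otimes>\<^bsub>sect F (topspace SpecZ)\<^esub> s = s"
    and generic: "germ SpecZ F eta_fin (topspace SpecZ) s = str (stalk SpecZ F eta_fin) c"
  shows "s = str (sect F (topspace SpecZ)) c"
proof -
  let ?X = "topspace SpecZ"
  interpret f12_sheaf SpecZ F
    using F by (simp add: is_finite_structure_sheaf_def)
  have str_stalk: "str (stalk SpecZ F x) d = germ SpecZ F x ?X (str (sect F ?X) d)" for x d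
    by (simp add: stalk_def)
  have X: "openin SpecZ ?X"
    by simp
  show ?thesis
  proof (rule eq_if_germs_eq[OF X s str_closed[OF X]])
    fix x assume x: "x \<in> ?X"
    then have "primeideal x \<Z>"
      by (simp add: topspace_SpecZ)
    then show "germ SpecZ F x ?X s = germ SpecZ F x ?X (str (sect F ?X) c)"
    proof (cases rule: primeideal_int_cases)
      case 1
      then show ?thesis
        using generic str_stalk by simp
    next
      case (2 p)
      let ?M = "F12_monoid_algebra ((H p)\<lparr>carrier := Hpos p\<rparr>)"
      let ?g = "germ SpecZ F x ?X s"
      obtain f where f: "f \<in> f12_iso (stalk SpecZ F x) ?M"
        using F 2 by (auto simp: is_finite_structure_sheaf_def)
      then have f_mult: "\<And>a b. a \<in> carrier (stalk SpecZ F x) \<Longrightarrow> b \<in> carrier (stalk SpecZ F x) \<Longrightarrow>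
          f (a \<otimes>\<^bsub>stalk SpecZ F x\<^esub> b) = f a \<otimes>\<^bsub>?M\<^esub> f b"
        and f_str: "\<And>d. f (str (stalk SpecZ F x) d) = str ?M d"
        and f_closed: "\<And>a. a \<in> carrier (stalk SpecZ F x) \<Longrightarrow> f a \<in> carrier ?M"
        and f_inj: "inj_on f (carrier (stalk SpecZ F x))"
        by (auto simp: f12_iso_def f12_hom_def hom_def bij_betw_def)
      have ss: "s \<otimes>\<^bsub>sect F ?X\<^esub> s \<in> carrier (sect F ?X)"
        using s by (intro mult_closed) auto
      have g: "?g \<in> carrier (stalk SpecZ F x)"
        using x s by (intro germ_closed) auto
      have gg: "?g \<otimes>\<^bsub>stalk SpecZ F x\<^esub> ?g \<in> carrier (stalk SpecZ F x)"
        using x s ss germ_closed[OF X x ss] by (simp add: germ_mult)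
      have "?g \<otimes>\<^bsub>stalk SpecZ F x\<^esub> ?g \<otimes>\<^bsub>stalk SpecZ F x\<^esub> ?g = ?g"
        using x s ss cube by (simp add: germ_mult)
      then have "f ?g \<otimes>\<^bsub>?M\<^esub> f ?g \<otimes>\<^bsub>?M\<^esub> f ?g = f ?g"
        using f_mult[OF gg g] f_mult[OF g g] by simp
      \<comment> \<open>A priori \<open>d\<close> depends on \<open>p\<close>; it is compared with
        \<open>c\<close> at the generic point below.\<close>
      then obtain d where "f ?g = str ?M d"
        using cube_fixed_constant[OF H[OF 2(1)] f_closed[OF g]]
        by (auto simp: F12_monoid_algebra_def)
      then have "f ?g = f (str (stalk SpecZ F x) d)"
        by (simp add: f_str)
      then have gd: "?g = germ SpecZ F x ?X (str (sect F ?X) d)"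
        using inj_onD[OF f_inj _ g] germ_closed[OF X x str_closed[OF X]] by (simp add: str_stalk)
      then obtain W where W: "openin SpecZ W" "x \<in> W" "W \<subseteq> ?X"
        "rest F ?X W s = rest F ?X W (str (sect F ?X) d)"
        using germ_eq_iff[OF X X x x s str_closed[OF X]] by auto
      have eta: "eta_fin \<in> W" "eta_fin \<in> ?X"
        using W eta_fin_in_open by auto
      \<comment> \<open>The neighbourhood \<open>W\<close> of the closed point also witnesses an
        equality of germs at the generic point.\<close>
      have "germ SpecZ F eta_fin ?X s = germ SpecZ F eta_fin ?X (str (sect F ?X) d)"
        using germ_eq_iff[OF X X eta(2) eta(2) s str_closed[OF X]] W eta(1) by auto
      then have "str (stalk SpecZ F eta_fin) c = str (stalk SpecZ F eta_fin) d"
        using generic str_stalk by simp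
      \<comment> \<open>The generic stalk is isomorphic to \<open>F12\<close>, so distinct constants
        have distinct germs there.\<close>
      then have "c = d"
        using str_injective_if_iso_F12 F by (fastforce simp: is_finite_structure_sheaf_def)
      then show ?thesis
        using gd by simp
    qed
  qed
qed

section \<open>Normal forms on the archimedean component\<close>

lemma comm_monoid_TJ: "comm_monoid (TJ_monoid x)"
  by (cases x; unfold_locales) (auto simp: TJ_monoid_def)

lemma f12_algebra_monoid_algebra:
  assumes "comm_monoid M"
  shows "f12_algebra (F12_monoid_algebra M)"
proof -
  interpret M: comm_monoid M by fact
  show ?thesis
  \<comment> \<open>Goals 2, 6 and 9 are associativity, commutativity and the multiplicativity of
    the structure map; the remaining ones follow by unfolding.\<close>
  proof (unfold_locales, goal_cases)
    case (2 x y z)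
    then show ?case
      by (cases x; cases y; cases z) (auto simp: F12_monoid_algebra_def M.m_assoc)
  next
    case (6 x y)
    then show ?case
      by (cases x; cases y) (auto simp: F12_monoid_algebra_def M.m_comm)
  next
    case 9
    have "str (F12_monoid_algebra M) (f12_mult c d) =
      str (F12_monoid_algebra M) c \<otimes>\<^bsub>F12_monoid_algebra M\<^esub> str (F12_monoid_algebra M) d" for c d
      by (cases c; cases d) (auto simp: F12_monoid_algebra_def)
    moreover have "str (F12_monoid_algebra M) c \<in> carrier (F12_monoid_algebra M)" for c
      by (cases c) (auto simp: F12_monoid_algebra_def)
    ultimately show ?case
      by (auto simp: hom_def F12_def)
  qed (auto simp: F12_monoid_algebra_def)
qed

context f12_algebra
begin

lemma f12_cong_carrier: "(x, y) \<in> f12_cong A R \<Longrightarrow> x \<in> carrier A \<and> y \<in> carrier A"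
  by (induction rule: f12_cong.induct) auto

text \<open>The quotient multiplies classes as sets and then saturates. All products of
  representatives are congruent, so the outcome is one class.\<close>

lemma f12_quot_mult:
  assumes x: "x \<in> carrier A" and y: "y \<in> carrier A"
  shows "f12_cong A R `` {x} \<otimes>\<^bsub>f12_quot A R\<^esub> f12_cong A R `` {y} = f12_cong A R `` {x \<otimes> y}"
proof -
  let ?C = "f12_cong A R"
  have related: "(x \<otimes> y, x' \<otimes> y') \<in> ?C" if "(x, x') \<in> ?C" "(y, y') \<in> ?C" for x' y'
  proof -
    have c: "x' \<in> carrier A" "y' \<in> carrier A"
      using that f12_cong_carrier by blast+
    \<comment> \<open>\<open>cong_mult\<close> multiplies on the left only: first \<open>x\<close>
      is changed next to \<open>y\<close>, then \<open>y\<close> next to \<open>x'\<close>, and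
      commutativity joins the two moves.\<close>
    have "(y \<otimes> x, y \<otimes> x') \<in> ?C" "(x' \<otimes> y, x' \<otimes> y') \<in> ?C"
      using that c y by (auto intro: cong_mult)
    then show ?thesis
      using c x y m_comm by (metis cong_trans)
  qed
  have "x \<otimes> y \<in> ?C `` {x} <#> ?C `` {y}"
    using x y by (auto simp: set_mult_def intro: cong_refl)
  moreover have "\<And>z. z \<in> ?C `` {x} <#> ?C `` {y} \<Longrightarrow> (x \<otimes> y, z) \<in> ?C"
    using related by (auto simp: set_mult_def)
  ultimately have "?C `` (?C `` {x} <#> ?C `` {y}) = ?C `` {x \<otimes> y}"
    by (blast intro: cong_trans)
  then show ?thesis
    by (simp add: f12_quot_def)
qed

end

section \<open>Normal forms modulo \<open>J^2 = epsilon\<close>\<close>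

abbreviation TJ_alg :: "arch_pt \<Rightarrow> (int \<times> nat) monomial f12_alg" where
  "TJ_alg x \<equiv> F12_monoid_algebra (TJ_monoid x)"

text \<open>The relation is applied \<open>k div 2\<close> times, and each application contributes a
  factor epsilon.\<close>

fun J_normal :: "(int \<times> nat) monomial \<Rightarrow> (int \<times> nat) monomial" where
  "J_normal Nul = Nul"
| "J_normal (Mon a (n, k)) = Mon (a \<noteq> odd (k div 2)) (n, k mod 2)"

lemma TJ_alg_simps [simp]:
  "Nul \<in> carrier (TJ_alg x)"
  "Mon a (n, k) \<in> carrier (TJ_alg x) \<longleftrightarrow> n \<in> T_exponents x"
  "Mon a (n, k) \<otimes>\<^bsub>TJ_alg x\<^esub> Mon b (m, l) = Mon (a \<noteq> b) (n + m, k + l)"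
  "Nul \<otimes>\<^bsub>TJ_alg x\<^esub> z = Nul"
  "z \<otimes>\<^bsub>TJ_alg x\<^esub> Nul = Nul"
  by (cases z; auto simp: F12_monoid_algebra_def TJ_monoid_def)+

interpretation TJ: f12_algebra "TJ_alg x" for x
  by (intro f12_algebra_monoid_algebra comm_monoid_TJ)

text \<open>This makes equality of normal forms stable under multiplication, which is the case
  \<open>cong_mult\<close> in the induction for \<open>arch_cong_iff\<close>.\<close>

lemma J_normal_mult: "J_normal (z \<otimes>\<^bsub>TJ_alg x\<^esub> y) = J_normal (z \<otimes>\<^bsub>TJ_alg x\<^esub> J_normal y)"
proof (cases z; cases y)
  fix b and q :: "int \<times> nat" and a and r :: "int \<times> nat"
  assume zy: "z = Mon b q" "y = Mon a r"
  obtain m j n k where qr: "q = (m, j)" "r = (n, k)"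
    by fastforce
  have "(j + k) div 2 = k div 2 + (j + k mod 2) div 2" "(j + k) mod 2 = (j + k mod 2) mod 2"
    by presburger+
  then show ?thesis
    by (auto simp: zy qr)
qed auto

text \<open>Induction lowering the exponent of J by 2, at the price of one factor epsilon.\<close>

lemma J_normal_cong: "Mon a (n, k) \<in> carrier (TJ_alg x) \<Longrightarrow>
  (Mon a (n, k), J_normal (Mon a (n, k))) \<in> arch_cong x"
proof (induction k arbitrary: a rule: less_induct)
  case (less k)
  show ?case
  proof (cases "k < 2")
    case True
    then show ?thesis
      using less.prems by (auto simp: arch_cong_def intro: cong_refl)
  next
    case False
    then obtain l where k: "k = l + 2"
      by (metis add.commute le_Suc_ex not_less)
    have "(Mon False (0, 2), Mon True (0, 0)) \<in> arch_cong x"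
      unfolding arch_cong_def by (rule cong_base) (cases x; auto simp: J_relation_def)+
    \<comment> \<open>The defining relation, multiplied by \<open>Mon a (n, l)\<close>, rewrites
      \<open>J^(l+2)\<close> as \<open>epsilon J^l\<close>.\<close>
    then have "(Mon a (n, l) \<otimes>\<^bsub>TJ_alg x\<^esub> Mon False (0, 2), Mon a (n, l) \<otimes>\<^bsub>TJ_alg x\<^esub> Mon True (0, 0)) \<in> arch_cong x"
      using less.prems unfolding arch_cong_def by (intro cong_mult) auto
    moreover have "(Mon (\<not> a) (n, l), J_normal (Mon (\<not> a) (n, l))) \<in> arch_cong x"
      using less.IH[of l "\<not> a"] less.prems k by auto
    moreover have "J_normal (Mon (\<not> a) (n, l)) = J_normal (Mon a (n, k))"
      by (simp add: k)
    ultimately show ?thesis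
      unfolding arch_cong_def k by (simp del: J_normal.simps) (metis cong_trans)
  qed
qed

text \<open>The generated congruence becomes decidable by computation: normal forms are invariant
  under each generating rule, and every element is congruent to its own normal form.\<close>

lemma arch_cong_iff:
  "(y, z) \<in> arch_cong x \<longleftrightarrow> y \<in> carrier (TJ_alg x) \<and> z \<in> carrier (TJ_alg x) \<and> J_normal y = J_normal z"
proof
  assume yz: "(y, z) \<in> arch_cong x"
  then have "(y, z) \<in> f12_cong (TJ_alg x) J_relation"
    by (simp add: arch_cong_def)
  then have "J_normal y = J_normal z"
    by (induction rule: f12_cong.induct) (auto simp: J_relation_def, metis J_normal_mult)
  then show "y \<in> carrier (TJ_alg x) \<and> z \<in> carrier (TJ_alg x) \<and> J_normal y = J_normal z"
    using yz TJ.f12_cong_carrier by (auto simp: arch_cong_def)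
next
  have self: "(y, J_normal y) \<in> arch_cong x" if "y \<in> carrier (TJ_alg x)" for y
  proof (cases y)
    case Nul
    then show ?thesis
      by (simp add: arch_cong_def cong_refl)
  next
    case (Mon a q)
    then show ?thesis
      using that J_normal_cong by (cases q) blast
  qed
  assume "y \<in> carrier (TJ_alg x) \<and> z \<in> carrier (TJ_alg x) \<and> J_normal y = J_normal z"
  then show "(y, z) \<in> arch_cong x"
    using self[of y] self[of z] unfolding arch_cong_def by (metis cong_sym cong_trans)
qed

section \<open>Restriction and involution on classes\<close>

lemma res_monomial_carrier: "y \<in> carrier (TJ_alg x) \<Longrightarrow> res_monomial x y \<in> carrier (TJ_alg Eta)"
  by (cases "(x, y)" rule: res_monomial.cases) auto

lemma alpha_monomial_carrier:
  "y \<in> carrier (TJ_alg (alpha_pt x)) \<Longrightarrow> alpha_monomial x y \<in> carrier (TJ_alg x)"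
  by (cases "(x, y)" rule: alpha_monomial.cases) auto

text \<open>The sign twist depends on the exponent of J only through its parity, which reduction
  modulo 2 keeps. Hence the map descends to classes.\<close>

lemma J_normal_res: "J_normal (res_monomial x y) = res_monomial x (J_normal y)"
  by (cases "(x, y)" rule: res_monomial.cases) auto

lemma J_normal_alpha: "J_normal (alpha_monomial x y) = alpha_monomial x (J_normal y)"
  by (cases "(x, y)" rule: alpha_monomial.cases) auto

text \<open>The twist at \<open>Minus\<close> is determined by the exponent of J, which the map
  leaves unchanged, so it can be undone.\<close>

lemma res_monomial_inj: "res_monomial x y = res_monomial x z \<Longrightarrow> y = z"
  by (cases "(x, y)" rule: res_monomial.cases; cases "(x, z)" rule: res_monomial.cases) auto

text \<open>\<open>arch_res\<close> takes the image of a whole class; congruent representatives have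
  congruent images, so any one of them computes the result.\<close>

lemma arch_res_class:
  assumes "y \<in> carrier (TJ_alg x)"
  shows "arch_res x (arch_cong x `` {y}) = arch_cong Eta `` {res_monomial x y}"
  unfolding arch_res_def using assms
  by (auto simp: arch_cong_iff res_monomial_carrier J_normal_res)

lemma arch_alpha_class:
  assumes "y \<in> carrier (TJ_alg (alpha_pt x))"
  shows "arch_alpha x (arch_cong (alpha_pt x) `` {y}) = arch_cong x `` {alpha_monomial x y}"
  unfolding arch_alpha_def using assms
  by (auto simp: arch_cong_iff alpha_monomial_carrier J_normal_alpha)

lemma carrier_arch_algE:
  assumes "C \<in> carrier (arch_alg x)"
  obtains y where "y \<in> carrier (TJ_alg x)" "C = arch_cong x `` {y}"
  using assms by (auto simp: arch_alg_def f12_quot_def arch_cong_def elim: quotientE)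

lemma arch_class_eq_iff:
  assumes "y \<in> carrier (TJ_alg x)" "z \<in> carrier (TJ_alg x)"
  shows "arch_cong x `` {y} = arch_cong x `` {z} \<longleftrightarrow> J_normal y = J_normal z"
  using assms by (auto simp: arch_cong_iff)

text \<open>Restriction commutes with passing to normal forms and is injective on monomials, hence
  also on classes.\<close>

lemma arch_res_inj: "inj_on (arch_res x) (carrier (arch_alg x))"
proof (rule inj_onI)
  fix C D
  assume "C \<in> carrier (arch_alg x)" "D \<in> carrier (arch_alg x)" and eq: "arch_res x C = arch_res x D"
  then obtain y z where "y \<in> carrier (TJ_alg x)" "C = arch_cong x `` {y}"
    "z \<in> carrier (TJ_alg x)" "D = arch_cong x `` {z}"
    by (elim carrier_arch_algE)
  then show "C = D"
    using eq by (auto simp: arch_res_class arch_class_eq_iff res_monomial_carrier J_normal_res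
        dest: res_monomial_inj)
qed

section \<open>Constants on the archimedean component\<close>

text \<open>One representative serves all three points, because the exponent 0 of T is allowed at
  each of them.\<close>

definition const_monomial :: "f12 \<Rightarrow> (int \<times> nat) monomial" where
  "const_monomial c = (case c of F0 \<Rightarrow> Nul | F1 \<Rightarrow> Mon False (0, 0) | Feps \<Rightarrow> Mon True (0, 0))"

lemma const_monomial_carrier: "const_monomial c \<in> carrier (TJ_alg x)"
  by (cases c; cases x) (auto simp: const_monomial_def)

lemma res_const: "res_monomial x (const_monomial c) = const_monomial c"
  by (cases c; cases x) (auto simp: const_monomial_def)

lemma alpha_const: "alpha_monomial x (const_monomial c) = const_monomial c"
  by (cases c; cases x) (auto simp: const_monomial_def)

lemma str_arch_alg: "str (arch_alg x) c = arch_cong x `` {const_monomial c}"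
  by (cases c) (auto simp: arch_alg_def f12_quot_def arch_cong_def F12_monoid_algebra_def
      const_monomial_def TJ_monoid_def)

lemma one_arch_alg: "\<one>\<^bsub>arch_alg x\<^esub> = str (arch_alg x) F1"
  by (simp add: arch_alg_def f12_quot_def F12_monoid_algebra_def)

lemma pt_arch_alg: "pt (arch_alg x) = str (arch_alg x) F0"
  by (simp add: arch_alg_def f12_quot_def F12_monoid_algebra_def)

lemma str_arch_alg_carrier: "str (arch_alg x) c \<in> carrier (arch_alg x)"
  using const_monomial_carrier[of c x]
  by (simp add: str_arch_alg arch_cong_def) (simp add: arch_alg_def f12_quot_def quotientI)

lemma str_arch_alg_mult:
  "str (arch_alg x) (f12_mult c d) = str (arch_alg x) c \<otimes>\<^bsub>arch_alg x\<^esub> str (arch_alg x) d"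
proof -
  have "const_monomial (f12_mult c d) = const_monomial c \<otimes>\<^bsub>TJ_alg x\<^esub> const_monomial d"
    by (cases c; cases d) (auto simp: const_monomial_def)
  then show ?thesis
    using TJ.f12_quot_mult[OF const_monomial_carrier const_monomial_carrier, of x J_relation c d]
    by (simp add: str_arch_alg arch_cong_def) (simp add: arch_alg_def)
qed

lemma arch_res_str: "arch_res x (str (arch_alg x) c) = str (arch_alg Eta) c"
  by (simp add: str_arch_alg arch_res_class const_monomial_carrier res_const)

lemma arch_alpha_str: "arch_alpha x (str (arch_alg (alpha_pt x)) c) = str (arch_alg x) c"
  by (simp add: str_arch_alg arch_alpha_class const_monomial_carrier alpha_const)

section \<open>Global invariant sections on the archimedean quotient\<close>

lemma openin_C_inf:
  "openin C_inf V \<longleftrightarrow> V \<subseteq> range alpha_orbit \<and> openin arch_topology (alpha_orbit -` V)"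
  unfolding C_inf_def topology_inverse'[OF istopology_C_inf] by (rule refl)

lemma topspace_C_inf: "topspace C_inf = range alpha_orbit"
proof -
  have "openin arch_topology UNIV"
    unfolding arch_topology_def topology_inverse'[OF istopology_arch]
    by (subst arch_opens_iff) simp
  moreover have "alpha_orbit -` range alpha_orbit = UNIV"
    by auto
  ultimately have "openin C_inf (range alpha_orbit)"
    by (simp add: openin_C_inf)
  then show ?thesis
    by (meson openin_C_inf openin_subset openin_topspace subset_antisym)
qed

text \<open>Over the whole space the preimage under \<open>alpha_orbit\<close> is everything, so the
  restricted functions in \<open>O_arch\<close> and \<open>alpha_star\<close> become plain
  ones.\<close>

lemma O_inf_global:
  "sect O_inf (topspace C_inf) =
    \<lparr>carrier = {s \<in> (\<Pi>\<^sub>E x\<in>UNIV. carrier (arch_alg x)).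
        (\<forall>x. s Eta = arch_res x (s x)) \<and> (\<forall>x. arch_alpha x (s (alpha_pt x)) = s x)},
     mult = (\<lambda>s t x. s x \<otimes>\<^bsub>arch_alg x\<^esub> t x),
     one = (\<lambda>x. \<one>\<^bsub>arch_alg x\<^esub>),
     pt = (\<lambda>x. pt (arch_alg x)),
     str = (\<lambda>c x. str (arch_alg x) c)\<rparr>"
proof -
  have "alpha_orbit x \<in> topspace C_inf" for x
    by (simp add: topspace_C_inf)
  moreover from this have "alpha_orbit -` topspace C_inf = UNIV"
    by auto
  ultimately show ?thesis
    by (simp add: O_inf_def O_arch_def alpha_star_def fun_eq_iff)
qed

lemma str_O_inf_carrier: "str (sect O_inf (topspace C_inf)) c \<in> carrier (sect O_inf (topspace C_inf))"
  by (simp add: O_inf_global PiE_def extensional_def str_arch_alg_carrier arch_res_str arch_alpha_str)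

lemma archimedean_section_constant:
  assumes t: "t \<in> carrier (sect O_inf (topspace C_inf))"
    and generic: "germ C_inf O_inf eta_inf (topspace C_inf) t = str (stalk C_inf O_inf eta_inf) c"
  shows "t = str (sect O_inf (topspace C_inf)) c"
proof -
  let ?Y = "topspace C_inf"
  have eta_inf_in: "eta_inf \<in> ?Y"
    by (simp add: eta_inf_def topspace_C_inf)
  \<comment> \<open>Reflexivity places \<open>t\<close> in its own germ, hence in that of the
    constant; this extracts a neighbourhood \<open>W\<close> on which both agree.\<close>
  have "((?Y, t), (?Y, t)) \<in> germ_rel C_inf O_inf eta_inf"
    using t eta_inf_in by (auto simp: germ_rel_def local_sections_def intro!: exI[of _ ?Y])
  then have "(?Y, t) \<in> germ C_inf O_inf eta_inf ?Y (str (sect O_inf ?Y) c)"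
    using generic by (auto simp: germ_def stalk_def)
  then obtain W where W: "eta_inf \<in> W"
    "rest O_inf ?Y W (str (sect O_inf ?Y) c) = rest O_inf ?Y W t"
    by (auto simp: germ_def germ_rel_def)
  \<comment> \<open>Restriction in \<open>O_arch\<close> is restriction of functions, and
    \<open>Eta\<close> lies in the preimage of \<open>W\<close>.\<close>
  then have "t Eta = str (sect O_inf ?Y) c Eta"
    by (auto simp: O_inf_def O_arch_def eta_inf_def restrict_def dest!: fun_cong[of _ _ Eta])
  then have eta: "t Eta = str (arch_alg Eta) c"
    by (simp add: O_inf_global)
  have "t x = str (arch_alg x) c" for x
  proof (rule inj_onD[OF arch_res_inj])
    \<comment> \<open>Both sides equal the value at \<open>Eta\<close>, by the compatibility
      condition on sections.\<close>
    show "arch_res x (t x) = arch_res x (str (arch_alg x) c)"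
      using t eta by (auto simp: O_inf_global arch_res_str)
    show "t x \<in> carrier (arch_alg x)"
      using t by (auto simp: O_inf_global)
  qed (rule str_arch_alg_carrier)
  then show ?thesis
    by (simp add: O_inf_global fun_eq_iff)
qed

section \<open>Global sections\<close>

lemma topspace_glued:
  "topspace (glued_topology X x Y y) = glue_inl x y ` topspace X \<union> glue_inr x y ` topspace Y"
proof -
  let ?T = "glue_inl x y ` topspace X \<union> glue_inr x y ` topspace Y"
  note op = topology_inverse'[OF istopology_glued[of x y X Y], folded glued_topology_def]
  have "{z \<in> topspace X. glue_inl x y z \<in> ?T} = topspace X"
    "{z \<in> topspace Y. glue_inr x y z \<in> ?T} = topspace Y"
    by auto
  then have "openin (glued_topology X x Y y) ?T"
    unfolding op by simp
  moreover have "topspace (glued_topology X x Y y) \<subseteq> ?T"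
    using openin_topspace[of "glued_topology X x Y y"] unfolding op by blast
  ultimately show ?thesis
    by (meson openin_subset subset_antisym)
qed

lemma parts_of_curve:
  "fin_part (topspace curve) = topspace SpecZ" "inf_part (topspace curve) = topspace C_inf"
  by (auto simp: fin_part_def inf_part_def curve_def topspace_glued)

text \<open>Activates the fibre product condition of \<open>O_curve\<close>, which is imposed only
  on nonempty sets.\<close>

lemma curve_nonempty: "topspace curve \<noteq> {}"
  by (auto simp: curve_def topspace_glued topspace_C_inf)

text \<open>Constants satisfy \<open>c^3 = c\<close>, so the exponent can be lowered in steps of 2.
  Only multiplicativity and the unit on constants are assumed of \<open>A\<close>, so that no
  algebra laws for the sections of \<open>O_curve\<close> have to be established first.\<close>

lemma nat_pow_str:
  fixes n :: nat
  assumes "\<And>c d. str A (f12_mult c d) = str A c \<otimes>\<^bsub>A\<^esub> str A d" "str A F1 = \<one>\<^bsub>A\<^esub>" "odd n"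
  shows "str A c [^]\<^bsub>A\<^esub> n = str A c"
proof -
  have "str A c [^]\<^bsub>A\<^esub> Suc (2 * m) = str A c" for m
  proof (induction m)
    case 0
    show ?case
      using assms(1)[of F1 c] assms(2) by (simp add: nat_pow_def)
  next
    case (Suc m)
    have "str A c [^]\<^bsub>A\<^esub> Suc (2 * Suc m) = str A c \<otimes>\<^bsub>A\<^esub> str A c \<otimes>\<^bsub>A\<^esub> str A c"
      using Suc by (simp add: nat_pow_def)
    also have "\<dots> = str A (f12_mult (f12_mult c c) c)"
      by (simp add: assms(1))
    also have "f12_mult (f12_mult c c) c = c"
      by (cases c) auto
    finally show ?case .
  qed
  then show ?thesis
    using assms(3) by (metis oddE Suc_eq_plus1)
qed

lemma str_O_curve:
  assumes "f12_sheaf SpecZ F"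
  shows "str (sect (O_curve F) (topspace curve)) c \<in> carrier (sect (O_curve F) (topspace curve))"
    and "str (sect (O_curve F) (topspace curve)) (f12_mult c d) =
      str (sect (O_curve F) (topspace curve)) c \<otimes>\<^bsub>sect (O_curve F) (topspace curve)\<^esub>
      str (sect (O_curve F) (topspace curve)) d"
    and "str (sect (O_curve F) (topspace curve)) F1 = \<one>\<^bsub>sect (O_curve F) (topspace curve)\<^esub>"
    and "str (sect (O_curve F) (topspace curve)) F0 = pt (sect (O_curve F) (topspace curve))"
proof -
  interpret F: f12_sheaf SpecZ F by fact
  interpret A: f12_algebra "sect F (topspace SpecZ)"
    by (simp add: F.sect_alg)
  note O_curve_def [simp] parts_of_curve [simp] Let_def [simp]
  show "str (sect (O_curve F) (topspace curve)) c \<in> carrier (sect (O_curve F) (topspace curve))"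
    \<comment> \<open>The same constant is the common germ demanded on both sides of the fibre
      product.\<close>
    by (auto simp: F.str_closed str_O_inf_carrier stalk_def)
  show "str (sect (O_curve F) (topspace curve)) (f12_mult c d) =
      str (sect (O_curve F) (topspace curve)) c \<otimes>\<^bsub>sect (O_curve F) (topspace curve)\<^esub>
      str (sect (O_curve F) (topspace curve)) d"
    using A.str_hom by (simp add: O_inf_global str_arch_alg_mult hom_def F12_def)
  show "str (sect (O_curve F) (topspace curve)) F1 = \<one>\<^bsub>sect (O_curve F) (topspace curve)\<^esub>"
    by (simp add: O_inf_global one_arch_alg A.str_F1)
  show "str (sect (O_curve F) (topspace curve)) F0 = pt (sect (O_curve F) (topspace curve))"
    by (simp add: O_inf_global pt_arch_alg A.str_F0)
qed

lemma cube_fixed_section_constant: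
  assumes "\<And>p. prime p \<Longrightarrow> ordered_rank_one_group (H p) (Hpos p)"
    and "is_finite_structure_sheaf H Hpos F"
    and x: "x \<in> carrier (sect (O_curve F) (topspace curve))"
    and cube: "x \<otimes>\<^bsub>sect (O_curve F) (topspace curve)\<^esub> x \<otimes>\<^bsub>sect (O_curve F) (topspace curve)\<^esub> x = x"
  obtains c where "x = str (sect (O_curve F) (topspace curve)) c"
proof -
  obtain s t where st: "x = (s, t)"
    by fastforce
  note O_curve_def [simp] parts_of_curve [simp] Let_def [simp]
  obtain c where c: "germ SpecZ F eta_fin (topspace SpecZ) s = str (stalk SpecZ F eta_fin) c"
    "germ C_inf O_inf eta_inf (topspace C_inf) t = str (stalk C_inf O_inf eta_inf) c"
    using x curve_nonempty by (auto simp: st)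
  \<comment> \<open>Multiplication in \<open>O_curve\<close> is componentwise, so the cube equation
    for \<open>x\<close> gives one for \<open>s\<close>; the common \<open>c\<close> makes both
    components the same constant.\<close>
  have "s = str (sect F (topspace SpecZ)) c"
    using finite_section_constant[OF assms(1,2) _ _ c(1)] x cube by (simp add: st)
  moreover have "t = str (sect O_inf (topspace C_inf)) c"
    using archimedean_section_constant[OF _ c(2)] x by (simp add: st)
  ultimately show ?thesis
    using that[of c] by (simp add: st)
qed

text \<open>The finite component already separates constants, through its generic stalk.\<close>

lemma str_O_curve_injective:
  assumes "is_finite_structure_sheaf H Hpos F"
    and "str (sect (O_curve F) (topspace curve)) c = str (sect (O_curve F) (topspace curve)) d"
  shows "c = d"
proof -
  have "str (sect F (topspace SpecZ)) c = str (sect F (topspace SpecZ)) d"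
    using assms(2) by (simp add: O_curve_def parts_of_curve Let_def)
  then have "str (stalk SpecZ F eta_fin) c = str (stalk SpecZ F eta_fin) d"
    by (simp add: stalk_def)
  then show ?thesis
    using str_injective_if_iso_F12 assms(1) by (fastforce simp: is_finite_structure_sheaf_def)
qed

theorem proposition7p3:
  fixes H :: "nat \<Rightarrow> 'h monoid" and Hpos :: "nat \<Rightarrow> 'h set"
    and Ofin :: "(int set, 'a) presheaf"
  assumes "\<And>p. prime p \<Longrightarrow> ordered_rank_one_group (H p) (Hpos p)"
    and "is_finite_structure_sheaf H Hpos Ofin"
  shows "str (topos_global_sections curve (O_curve Ofin))
           \<in> f12_iso F12 (topos_global_sections curve (O_curve Ofin))"
proof -
  define A where "A = sect (O_curve Ofin) (topspace curve)"
  define G where "G = topos_global_sections curve (O_curve Ofin)"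
  have G: "carrier G = odd_hom odd_terminal (frobenius_odd_set A)" "mult G = (\<lambda>f g u. f u \<otimes>\<^bsub>A\<^esub> g u)"
    "one G = (\<lambda>u. \<one>\<^bsub>A\<^esub>)" "pt G = (\<lambda>u. pt A)" "str G = (\<lambda>c u. str A c)"
    by (simp_all add: G_def A_def topos_global_sections_def Let_def)
  have "f12_sheaf SpecZ Ofin"
    using assms(2) by (simp add: is_finite_structure_sheaf_def)
  note A = str_O_curve[OF this, folded A_def]
  \<comment> \<open>A morphism from the one-point object is its value at \<open>()\<close>, and
    equivariance says that all odd powers fix this value.\<close>
  have carrier_G: "f \<in> carrier G \<longleftrightarrow> f () \<in> carrier A \<and> (\<forall>n::nat. odd n \<longrightarrow> f () [^]\<^bsub>A\<^esub> n = f ())" for f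
    by (auto simp: G odd_hom_def odd_terminal_def frobenius_odd_set_def PiE_def extensional_def)
  have closed: "str G c \<in> carrier G" for c
    unfolding carrier_G using A(1) nat_pow_str[of A, OF A(2,3)] by (simp add: G)
  have "f \<in> range (str G)" if "f \<in> carrier G" for f
  proof -
    have "f () \<in> carrier A" and odd_pow: "\<And>n::nat. odd n \<Longrightarrow> f () [^]\<^bsub>A\<^esub> n = f ()"
      using that by (auto simp: carrier_G)
    \<comment> \<open>The first power unfolds to the unit times \<open>f ()\<close>, so the exponent
      1 supplies the left unit law needed to simplify the third power.\<close>
    moreover have "\<one>\<^bsub>A\<^esub> \<otimes>\<^bsub>A\<^esub> f () = f ()"
      using odd_pow[of 1] by (simp add: nat_pow_def)
    then have "f () \<otimes>\<^bsub>A\<^esub> f () \<otimes>\<^bsub>A\<^esub> f () = f ()"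
      using odd_pow[of 3] by (simp add: nat_pow_def numeral_3_eq_3)
    ultimately obtain c where "f () = str A c"
      using cube_fixed_section_constant[OF assms, folded A_def] by blast
    then have "f = str G c"
      by (simp add: G fun_eq_iff)
    then show ?thesis
      by blast
  qed
  then have "bij_betw (str G) UNIV (carrier G)"
    using closed str_O_curve_injective[OF assms(2), folded A_def]
    by (auto simp: bij_betw_def inj_on_def G fun_eq_iff)
  moreover have "str G \<in> f12_hom F12 G"
    using closed A by (auto simp: f12_hom_def hom_def F12_def G)
  ultimately show ?thesis
    by (simp add: f12_iso_def F12_def G_def)
qed

end
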